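(* Let $(a_n)_{n\ge 0}\in\mathbb{Z}^{\mathbb{N}}$ be a primary pseudo-polynomial, let $(b_n)_{n\ge 0}\in\mathbb{Z}^{\mathbb{N}}$ be its binomial transform, and let $f_a(x):=\sum_{n=0}^\infty a_nx^n$ and $f_b(x):=\sum_{n=0}^\infty b_nx^n$ in $\mathbb{Z}[[x]]$. (i) Assume there exists an integer $m\ge 0$ such that the $m$-th derivative $f_a^{(m)}(x)$ is algebraic over $\mathbb{Q}(x)$. Then $(a_n)_{n\ge 0}$ is a polynomial, and thus $f_a(x)\in\mathbb{Q}(x)$. (ii) If $f_b(x)$ is algebraic over $\mathbb{Q}(x)$, then $f_b(x)\in\mathbb{Z}[x]$.
   Context: $\mathbb{N}=\{0,1,2,\dots\}$. A sequence $(a_n)_{n\ge 0}\in\mathbb{Z}^{\mathbb{N}}$ is a primary pseudo-polynomial if for every integer $n\ge 0$ and every prime number $p$, $a_{n+p}\equiv a_n \pmod p$. The sequence $(a_n)_{n\ge 0}$ "is a polynomial" if there exists $P(X)\in\mathbb{Q}[X]$ such that $a_n=P(n)$ for all integers $n\ge 0$. The binomial transform of $(a_n)_{n\ge 0}$ is the sequence $(b_n)_{n\ge 0}$ defined by $b_n:=\sum_{k=0}^n(-1)^{n-k}\binom{n}{k}a_k$ for all $n\ge 0$. Derivatives of power series are formal derivatives with respect to $x$. *)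

theory Defs
  imports
    "HOL-Computational_Algebra.Computational_Algebra"
    "HOL-Number_Theory.Cong"
begin

definition primary_pseudo_polynomial :: "(nat \<Rightarrow> int) \<Rightarrow> bool" where
  "primary_pseudo_polynomial a \<longleftrightarrow>
     (\<forall>(n::nat) (p::nat). prime p \<longrightarrow> [a (n + p) = a n] (mod int p))"

definition is_polynomial_seq :: "(nat \<Rightarrow> int) \<Rightarrow> bool" where
  "is_polynomial_seq a \<longleftrightarrow> (\<exists>P :: rat poly. \<forall>n. of_int (a n) = poly P (of_nat n))"

definition binomial_transform :: "(nat \<Rightarrow> int) \<Rightarrow> nat \<Rightarrow> int" where
  "binomial_transform a n = (\<Sum>k\<le>n. (-1) ^ (n - k) * int (n choose k) * a k)"

(* The embeddings of Z[[x]] and Q(x) into the field Q((x)) of formal Laurent series;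
   algebraicity over Q(x) and membership in Q(x) are understood inside Q((x)). *)

definition int_fps_to_rat_fls :: "int fps \<Rightarrow> rat fls" where
  "int_fps_to_rat_fls f = fps_to_fls (Abs_fps (\<lambda>n. rat_of_int (fps_nth f n)))"

definition rational_functions :: "rat fls set" where
  "rational_functions =
     {fps_to_fls (fps_of_poly p) / fps_to_fls (fps_of_poly q) | p q :: rat poly. q \<noteq> 0}"

(* Only meant for K a subfield; cf. the constant algebraic in Polynomial,
   where the base field is fixed to be the rationals. *)
definition algebraic_over :: "'a::field set \<Rightarrow> 'a \<Rightarrow> bool" where
  "algebraic_over K x \<longleftrightarrow> (\<exists>P. P \<noteq> 0 \<and> (\<forall>i. coeff P i \<in> K) \<and> poly P x = 0)"

end

theory Submission
  imports Defs
begin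

text \<open>
  The proof compares degrees modulo primes. Let \<open>b\<close> be the binomial transform of the primary
  pseudo-polynomial \<open>a\<close>, and let \<open>f_a\<close>, \<open>f_b\<close> be the generating functions. Since
  \<open>b n = (\<Delta>^n a) 0\<close> and \<open>\<Delta>^p\<close> is the \<open>p\<close>-step difference modulo \<open>p\<close>, every prime \<open>p \<le> n\<close>
  divides \<open>b n\<close> (\<open>prime_dvd_binomial_transform\<close>). Hence \<open>f_b\<close> is a polynomial modulo each prime.

  If \<open>f_b\<close> is algebraic, it satisfies a nontrivial equation whose coefficients are integer polynomials of
  degree at most some \<open>d\<close>. A polynomial solution of such an equation has degree at most \<open>d\<close>
  (\<open>degree_bound_mod_prime\<close>). Applied modulo almost all primes, this shows that each \<open>b k\<close> with
  \<open>k > d\<close> is divisible by almost all primes and so is 0. Therefore \<open>f_b\<close> is a polynomial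
  (\<open>algebraic_divisible_imp_finite\<close>).

  If instead \<open>f_a\<close> is algebraic, then so is \<open>f_b\<close>, because \<open>(1 + x) * f_b x = f_a (x / (1 + x))\<close>
  (\<open>algebraic_binomial_transform\<close>). So \<open>b\<close> vanishes from some index on, and binomial inversion
  makes \<open>a\<close> a polynomial. When only the \<open>m\<close>-th derivative of \<open>f_a\<close> is algebraic, the same applies to its
  coefficients, which again form a primary pseudo-polynomial. What remains is to divide by the factors that
  differentiation introduced: if \<open>n * a n\<close> is given by a polynomial for \<open>n > 0\<close>, the congruences
  for \<open>a\<close> force that polynomial to vanish at 0 (\<open>is_polynomial_seq_if_derivative\<close>).
\<close>

section \<open>Divisibility of the binomial transform by primes\<close>

lemma eq_0_if_almost_all_primes_dvd:
  fixes z :: int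
  assumes "\<And>p. prime p \<Longrightarrow> p > N \<Longrightarrow> int p dvd z"
  shows "z = 0"
proof (rule ccontr)
  assume "z \<noteq> 0"
  obtain p where p: "prime p" "p > max N (nat \<bar>z\<bar>)"
    using bigger_prime by blast
  hence "int p dvd z" using assms by auto
  with \<open>z \<noteq> 0\<close> have "int p \<le> \<bar>z\<bar>" by (simp add: zdvd_imp_le)
  with p show False by linarith
qed

definition forward_difference :: "(nat \<Rightarrow> int) \<Rightarrow> nat \<Rightarrow> int" where
  "forward_difference a n = a (Suc n) - a n"

lemma binomial_transform_0 [simp]: "binomial_transform a 0 = a 0"
  by (simp add: binomial_transform_def)

text \<open>
  Iterating this identity gives \<open>b n = (\<Delta>^n a) 0\<close>, which turns facts about the operator \<open>\<Delta>\<close>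
  into facts about the binomial transform.
\<close>

lemma binomial_transform_Suc:
  "binomial_transform a (Suc n) = binomial_transform (forward_difference a) n"
proof -
  have "binomial_transform a (Suc n) =
      (-1) ^ Suc n * a 0 + (\<Sum>k\<le>n. (-1) ^ (n - k) * int (Suc n choose Suc k) * a (Suc k))"
    unfolding binomial_transform_def by (subst sum.atMost_Suc_shift) simp
  also have "\<dots> = (\<Sum>k\<le>n. (-1) ^ (n - k) * int (n choose k) * a (Suc k)) +
      ((-1) ^ Suc n * a 0 + (\<Sum>k\<le>n. (-1) ^ (n - k) * int (n choose Suc k) * a (Suc k)))"
    by (simp add: algebra_simps sum.distrib)
  also have "(-1) ^ Suc n * a 0 + (\<Sum>k\<le>n. (-1) ^ (n - k) * int (n choose Suc k) * a (Suc k))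
      = (\<Sum>k\<le>Suc n. (-1) ^ (Suc n - k) * int (n choose k) * a k)"
    by (subst sum.atMost_Suc_shift) simp
  also have "\<dots> = (\<Sum>k\<le>n. - ((-1) ^ (n - k) * int (n choose k) * a k))"
    by (simp add: Suc_diff_le)
  finally show ?thesis
    by (simp add: binomial_transform_def forward_difference_def sum_negf sum_subtractf
        right_diff_distrib)
qed

lemma binomial_transform_add:
  "binomial_transform a (m + n) = binomial_transform ((forward_difference ^^ m) a) n"
proof (induction m arbitrary: a)
  case (Suc m)
  then show ?case by (simp add: binomial_transform_Suc funpow_swap1)
qed simp

lemma binomial_inversion: "a n = (\<Sum>k\<le>n. int (n choose k) * binomial_transform a k)"
proof (induction n arbitrary: a)
  case (Suc n)
  let ?b = "binomial_transform a"
  have "a (Suc n) = a n + forward_difference a n"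
    by (simp add: forward_difference_def)
  also have "a n = (\<Sum>k\<le>Suc n. int (n choose k) * ?b k)"
    using Suc.IH[of a] by simp
  also have "\<dots> = ?b 0 + (\<Sum>k\<le>n. int (n choose Suc k) * ?b (Suc k))"
    by (subst sum.atMost_Suc_shift) simp
  also have "forward_difference a n = (\<Sum>k\<le>n. int (n choose k) * ?b (Suc k))"
    using Suc.IH[of "forward_difference a"] by (simp add: binomial_transform_Suc)
  also have "?b 0 + (\<Sum>k\<le>n. int (n choose Suc k) * ?b (Suc k)) + \<dots>
      = (\<Sum>k\<le>Suc n. int (Suc n choose k) * ?b k)"
    by (subst sum.atMost_Suc_shift) (simp add: algebra_simps sum.distrib)
  finally show ?case .
qed simp

lemma funpow_forward_difference:
  "(forward_difference ^^ m) a j = binomial_transform (\<lambda>k. a (j + k)) m"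
proof (induction m arbitrary: a)
  case (Suc m)
  have "(\<lambda>k. forward_difference a (j + k)) = forward_difference (\<lambda>k. a (j + k))"
    by (simp add: forward_difference_def fun_eq_iff)
  then show ?case
    using Suc.IH[of "forward_difference a"] by (simp add: binomial_transform_Suc funpow_swap1)
qed simp

text \<open>
  Let \<open>S\<close> be the shift operator, so that \<open>\<Delta> = S - 1\<close>. Modulo \<open>p\<close> the inner binomial
  coefficients of \<open>(S - 1)^p\<close> vanish, so \<open>\<Delta>^p = S^p - 1\<close>, and this operator sends a primary
  pseudo-polynomial to a sequence of multiples of \<open>p\<close>. Further differences preserve divisibility.
\<close>

lemma prime_dvd_binomial_transform:
  assumes "primary_pseudo_polynomial a" and p: "prime p" and "n \<ge> p"
  shows "int p dvd binomial_transform a n"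
proof -
  have dvd_diff: "int p dvd (forward_difference ^^ p) a j" for j
  proof -
    have split: "{..p} = insert 0 (insert p {0<..<p})" by auto
    have mid: "int p dvd (\<Sum>k\<in>{0<..<p}. (-1) ^ (p - k) * int (p choose k) * a (j + k))"
      using dvd_choose_prime[OF _ _ _ p] p by (intro dvd_sum) auto
    have "p > 0" using p by (simp add: prime_gt_0_nat)
    have "[a (j + p) = a j] (mod int p)"
      using assms by (simp add: primary_pseudo_polynomial_def)
    \<comment> \<open>The prime 2 needs its own case: there the constant term of \<open>(S - 1)^p\<close> is 1, not -1.\<close>
    moreover have "int p dvd (-1) ^ p + 1"
    proof (cases "p = 2")
      case False
      hence "odd p" using p primes_dvd_imp_eq two_is_prime_nat by blast
      thus ?thesis by simp
    qed simp
    ultimately have "int p dvd (a (j + p) - a j) + ((-1) ^ p + 1) * a j"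
      by (simp add: cong_iff_dvd_diff)
    hence ends: "int p dvd a (j + p) + (-1) ^ p * a j"
      by (simp add: algebra_simps)
    have "(forward_difference ^^ p) a j = a (j + p) + (-1) ^ p * a j +
        (\<Sum>k\<in>{0<..<p}. (-1) ^ (p - k) * int (p choose k) * a (j + k))"
      using \<open>p > 0\<close> unfolding funpow_forward_difference binomial_transform_def split by simp
    with ends mid show ?thesis by simp
  qed
  have "binomial_transform a n = binomial_transform ((forward_difference ^^ p) a) (n - p)"
    using \<open>n \<ge> p\<close> by (simp flip: binomial_transform_add)
  also have "int p dvd \<dots>"
    unfolding binomial_transform_def using dvd_diff by (intro dvd_sum) auto
  finally show ?thesis .
qed

section \<open>Polynomial equations modulo a prime\<close>

text \<open>
  The reduction of \<open>F\<close> modulo \<open>p\<close> is a polynomial of degree at most \<open>D\<close>. Phrasing this with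
  divisibility of integer coefficients makes it possible to let \<open>p\<close> vary.
\<close>

definition degree_mod_le :: "int \<Rightarrow> int fps \<Rightarrow> nat \<Rightarrow> bool" where
  "degree_mod_le p F D \<longleftrightarrow> (\<forall>n>D. p dvd fps_nth F n)"

lemma degree_mod_le_mult:
  assumes "degree_mod_le p F D" and "degree_mod_le p G E"
  shows "degree_mod_le p (F * G) (D + E)"
  unfolding degree_mod_le_def
proof safe
  fix n assume n: "n > D + E"
  have "p dvd fps_nth F i * fps_nth G (n - i)" if "i \<le> n" for i
    using assms n that by (cases "i > D") (auto simp: degree_mod_le_def)
  thus "p dvd fps_nth (F * G) n"
    by (auto simp: fps_mult_nth intro!: dvd_sum)
qed

lemma cong_top_coeff_mult:
  assumes "degree_mod_le p F D" and "degree_mod_le p G E"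
  shows "[fps_nth (F * G) (D + E) = fps_nth F D * fps_nth G E] (mod p)"
proof -
  have *: "p dvd fps_nth F i * fps_nth G (D + E - i)" if "i \<in> {0..D + E} - {D}" for i
    using assms that by (cases "i > D") (auto simp: degree_mod_le_def)
  have "fps_nth (F * G) (D + E) = fps_nth F D * fps_nth G E +
      (\<Sum>i\<in>{0..D + E} - {D}. fps_nth F i * fps_nth G (D + E - i))"
    unfolding fps_mult_nth by (subst sum.remove[of _ D]) auto
  moreover have "p dvd (\<Sum>i\<in>{0..D + E} - {D}. fps_nth F i * fps_nth G (D + E - i))"
    using * by (rule dvd_sum)
  ultimately show ?thesis by (simp add: cong_iff_dvd_diff)
qed

lemma degree_mod_le_power:
  assumes "degree_mod_le p F D"
  shows "degree_mod_le p (F ^ i) (i * D)"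
proof (induction i)
  case (Suc i)
  show ?case using degree_mod_le_mult[OF assms Suc.IH] by simp
qed (simp add: degree_mod_le_def)

lemma cong_top_coeff_power:
  assumes "degree_mod_le p F D"
  shows "[fps_nth (F ^ i) (i * D) = fps_nth F D ^ i] (mod p)"
proof (induction i)
  case (Suc i)
  have "[fps_nth (F ^ Suc i) (Suc i * D) = fps_nth F D * fps_nth (F ^ i) (i * D)] (mod p)"
    using cong_top_coeff_mult[OF assms degree_mod_le_power[OF assms]] by simp
  also have "[fps_nth F D * fps_nth (F ^ i) (i * D) = fps_nth F D * fps_nth F D ^ i] (mod p)"
    using Suc.IH by (rule cong_scalar_left)
  finally show ?case by simp
qed simp

text \<open>
  A polynomial solution \<open>y\<close> of a polynomial equation with coefficients of degree at most \<open>d\<close>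
  has degree at most \<open>d\<close>: if \<open>D = degree y\<close> exceeded \<open>d\<close>, the last nonzero term
  \<open>A I * y ^ I\<close>, of degree at least \<open>I * D\<close>, could not be cancelled by the earlier terms
  \<open>A i * y ^ i\<close>, whose degrees are at most \<open>i * D + d < (i + 1) * D\<close>. The argument is carried out
  modulo \<open>p\<close>. The a priori bound \<open>B\<close> only ensures that \<open>F\<close> is a polynomial modulo \<open>p\<close>; the resulting
  bound \<open>d\<close> is the same for all \<open>p\<close>.
\<close>

lemma degree_bound_mod_prime:
  fixes A :: "nat \<Rightarrow> int poly"
  assumes rel: "(\<Sum>i\<le>n. fps_of_poly (A i) * F ^ i) = 0"
    and deg: "\<And>i. i \<le> n \<Longrightarrow> degree (A i) \<le> d"
    and p: "prime p"
    and nonzero: "j \<le> n" "\<not> p dvd coeff (A j) e"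
    and bounded: "degree_mod_le p F B"
  shows "degree_mod_le p F d"
proof (rule ccontr)
  assume "\<not> degree_mod_le p F d"
  then obtain k where k: "k > d" "\<not> p dvd fps_nth F k"
    by (auto simp: degree_mod_le_def)
  define D where "D = Max {k. \<not> p dvd fps_nth F k}"
  have finD: "finite {k. \<not> p dvd fps_nth F k}"
    by (rule finite_subset[of _ "{..B}"])
      (use bounded in \<open>auto simp: degree_mod_le_def not_less[symmetric]\<close>)
  \<comment> \<open>\<open>D\<close> is the exact degree of \<open>F\<close> modulo \<open>p\<close>.\<close>
  have topD: "\<not> p dvd fps_nth F D"
    using Max_in[OF finD] k by (auto simp: D_def)
  have leD: "degree_mod_le p F D"
    unfolding degree_mod_le_def D_def using Max_ge[OF finD] not_le by blast
  have "D > d"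
    using Max_ge[OF finD, of k] k by (simp add: D_def)

  \<comment> \<open>\<open>I\<close> indexes the last term whose coefficient survives modulo \<open>p\<close>,
    and \<open>E\<close> is the degree of that coefficient modulo \<open>p\<close>.\<close>
  define S where "S = {i. i \<le> n \<and> (\<exists>e. \<not> p dvd coeff (A i) e)}"
  define I where "I = Max S"
  have finS: "finite S" by (simp add: S_def)
  have "S \<noteq> {}" using nonzero by (auto simp: S_def)
  hence "I \<in> S" using Max_in[OF finS] by (simp add: I_def)
  have aboveI: "p dvd coeff (A i) l" if "i \<le> n" "i > I" for i l
  proof -
    have "i \<notin> S" using Max_ge[OF finS, of i] that by (auto simp: I_def)
    thus ?thesis using that by (simp add: S_def)
  qed
  define T where "T = {l. \<not> p dvd coeff (A I) l}"
  define E where "E = Max T"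
  have "I \<le> n" using \<open>I \<in> S\<close> by (simp add: S_def)
  have "p dvd coeff (A I) l" if "l > d" for l
    using deg[OF \<open>I \<le> n\<close>] that by (simp add: coeff_eq_0)
  hence "T \<subseteq> {..d}"
    unfolding T_def using not_le by blast
  hence finT: "finite T" using finite_subset by blast
  have "T \<noteq> {}" using \<open>I \<in> S\<close> by (auto simp: S_def T_def)
  hence "E \<in> T" using Max_in[OF finT] by (simp add: E_def)
  hence topE: "\<not> p dvd coeff (A I) E" by (simp add: T_def)
  have leE: "degree_mod_le p (fps_of_poly (A I)) E"
    unfolding degree_mod_le_def E_def using Max_ge[OF finT] not_le by (force simp: T_def)

  let ?c = "\<lambda>i. fps_nth (fps_of_poly (A i) * F ^ i) (E + I * D)"
  have others: "p dvd ?c i" if "i \<in> {..n} - {I}" for i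
  proof (cases "i > I")
    case True
    thus ?thesis using that aboveI by (auto simp: fps_mult_nth intro!: dvd_sum)
  next
    case False
    with that have "Suc i \<le> I" "i \<le> n" by auto
    hence "Suc i * D \<le> I * D" by (intro mult_right_mono) auto
    hence "d + i * D < E + I * D" using \<open>D > d\<close> by simp
    moreover have "degree_mod_le p (fps_of_poly (A i)) d"
      using deg[OF \<open>i \<le> n\<close>] by (auto simp: degree_mod_le_def coeff_eq_0)
    ultimately show ?thesis
      using degree_mod_le_mult[OF _ degree_mod_le_power[OF leD]]
      by (auto simp: degree_mod_le_def)
  qed
  have "0 = (\<Sum>i\<le>n. ?c i)"
    using arg_cong[OF rel, of "\<lambda>G. fps_nth G (E + I * D)"] by (simp add: fps_sum_nth)
  also have "\<dots> = ?c I + (\<Sum>i\<in>{..n} - {I}. ?c i)"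
    using \<open>I \<le> n\<close> by (subst sum.remove[of _ I]) auto
  finally have "?c I = - (\<Sum>i\<in>{..n} - {I}. ?c i)"
    by linarith
  also have "p dvd \<dots>"
    using dvd_sum[OF others] by (rule dvd_minus_iff[THEN iffD2])
  finally have "p dvd ?c I" .
  moreover have "[?c I = coeff (A I) E * fps_nth (F ^ I) (I * D)] (mod p)"
    using cong_top_coeff_mult[OF leE degree_mod_le_power[OF leD, of I]] by simp
  ultimately have "p dvd coeff (A I) E * fps_nth (F ^ I) (I * D)"
    using cong_dvd_iff by blast
  hence "p dvd fps_nth (F ^ I) (I * D)"
    using topE p by (simp add: prime_dvd_mult_iff)
  hence "p dvd fps_nth F D ^ I"
    using cong_top_coeff_power[OF leD] cong_dvd_iff by blast
  thus False using topD p prime_dvd_power by blast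
qed

section \<open>Sequences of polynomial values\<close>

lemma clear_denominators:
  fixes p :: "rat poly"
  obtains D p' where "D \<noteq> 0" "map_poly of_int p' = smult (of_int D) p"
proof -
  have "\<exists>D p'. D \<noteq> 0 \<and> map_poly of_int p' = smult (of_int D) p"
  proof (induction p)
    case (pCons c p)
    then obtain D p' where D: "D \<noteq> 0" "map_poly of_int p' = smult (of_int D) p" by blast
    obtain u v where uv: "quotient_of c = (u, v)" by force
    hence "v > 0" and c: "c = of_int u / of_int v"
      by (auto simp: quotient_of_denom_pos quotient_of_div)
    have "map_poly of_int (pCons (D * u) (smult v p')) = smult (of_int (D * v)) (pCons c p)"
      using D(2) \<open>v > 0\<close> c by (simp add: map_poly_pCons map_poly_smult mult.commute)
    thus ?case using D(1) \<open>v > 0\<close> by (metis mult_eq_0_iff less_irrefl)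
  next
    case 0
    have "map_poly of_int 0 = smult (of_int 1) (0 :: rat poly)" by simp
    thus ?case by (metis zero_neq_one)
  qed
  thus ?thesis using that by blast
qed

lemma poly_map_poly_of_int:
  "poly (map_poly of_int p) (of_int x) = (of_int (poly p x) :: 'a :: {comm_ring_1, ring_char_0})"
  by (induction p) (auto simp: map_poly_pCons)

lemma diff_dvd_poly_diff:
  fixes x y :: "'a :: comm_ring_1"
  shows "x - y dvd poly p x - poly p y"
proof (induction p)
  case (pCons c p)
  have "poly (pCons c p) x - poly (pCons c p) y = x * (poly p x - poly p y) + (x - y) * poly p y"
    by (simp add: algebra_simps)
  thus ?case using pCons.IH by simp
qed simp

lemma binomial_coefficient_is_poly:
  "\<exists>P :: rat poly. \<forall>n. of_nat (n choose k) = poly P (of_nat n)"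
proof (intro exI allI)
  show "of_nat (n choose k) =
      poly (smult (1 / fact k) (\<Prod>i = 0..<k. [:- of_nat i, 1 :: rat:])) (of_nat n)" for n
    by (simp add: binomial_gbinomial gbinomial_prod_rev poly_prod)
qed

text \<open>
  By binomial inversion, the nonzero \<open>b k\<close> are the coordinates of \<open>a\<close> in the basis of the
  polynomials \<open>n choose k\<close>.
\<close>

lemma is_polynomial_seq_if_binomial_transform_finite:
  assumes "\<And>k. k > d \<Longrightarrow> binomial_transform a k = 0"
  shows "is_polynomial_seq a"
proof -
  obtain B :: "nat \<Rightarrow> rat poly" where B: "\<And>k n. of_nat (n choose k) = poly (B k) (of_nat n)"
    using binomial_coefficient_is_poly by metis
  have "of_int (a n) =
      poly (\<Sum>k\<le>d. smult (of_int (binomial_transform a k)) (B k)) (of_nat n)" for n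
  proof -
    have "a n = (\<Sum>k\<le>n. int (n choose k) * binomial_transform a k)"
      by (rule binomial_inversion)
    also have "\<dots> = (\<Sum>k\<le>max n d. int (n choose k) * binomial_transform a k)"
      by (rule sum.mono_neutral_left) auto
    also have "\<dots> = (\<Sum>k\<le>d. int (n choose k) * binomial_transform a k)"
      by (rule sum.mono_neutral_right) (auto simp: assms)
    finally have "rat_of_int (a n) = (\<Sum>k\<le>d. of_nat (n choose k) * of_int (binomial_transform a k))"
      by simp
    thus ?thesis by (simp add: poly_sum B mult.commute)
  qed
  thus ?thesis unfolding is_polynomial_seq_def by blast
qed

text \<open>
  This undoes one differentiation of the generating function. For \<open>n > 0\<close> the number \<open>n * a n\<close>
  is a value \<open>V n\<close> of a polynomial, and \<open>V 0\<close> is congruent to \<open>V p = p * a p\<close>, hence to 0,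
  modulo every prime \<open>p\<close> (up to the common denominator of \<open>V\<close>). So \<open>V 0 = 0\<close>, and dividing
  \<open>V\<close> by its variable yields a polynomial that interpolates \<open>a\<close> at the positive integers. At 0 it does
  so as well: its value there and \<open>a 0\<close> are both congruent to \<open>a p\<close> modulo \<open>p\<close>.
\<close>

lemma is_polynomial_seq_if_derivative:
  assumes a: "primary_pseudo_polynomial a"
    and der: "is_polynomial_seq (\<lambda>n. int (Suc n) * a (Suc n))"
  shows "is_polynomial_seq a"
proof -
  from der obtain U :: "rat poly"
    where U: "\<And>n. of_int (int (Suc n) * a (Suc n)) = poly U (of_nat n)"
    unfolding is_polynomial_seq_def by blast
  \<comment> \<open>\<open>V (n + 1) = U n\<close>, so that \<open>V n\<close> rather than \<open>V (n - 1)\<close> involves \<open>a n\<close>.\<close>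
  define V where "V = pcompose U [:-1, 1:]"
  have V: "poly V (of_nat n) = of_nat n * of_int (a n)" if "n > 0" for n
    using U[of "n - 1"] that by (simp add: V_def poly_pcompose of_nat_diff)
  have "poly V 0 = 0"
  proof -
    obtain D V' where D: "D \<noteq> 0" "map_poly of_int V' = smult (of_int D) V"
      by (rule clear_denominators)
    have "int p dvd poly V' 0" if "prime p" for p
    proof -
      have "p > 0" using that by (simp add: prime_gt_0_nat)
      have "rat_of_int (poly V' (int p)) = of_int (D * int p * a p)"
        using V[OF \<open>p > 0\<close>] D(2) by (simp flip: poly_map_poly_of_int)
      hence "int p dvd poly V' (int p)" by (simp only: of_int_eq_iff) simp
      moreover have "int p dvd poly V' (int p) - poly V' 0"
        using diff_dvd_poly_diff[of "int p" 0 V'] by simp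
      ultimately show ?thesis by (metis dvd_diff_right_iff)
    qed
    hence "poly V' 0 = 0" by (rule eq_0_if_almost_all_primes_dvd)
    thus ?thesis using poly_map_poly_of_int[of V' 0, where 'a = rat] D by simp
  qed
  then obtain A where "V = pCons 0 A" by (cases V) auto
  hence A: "of_int (a n) = poly A (of_nat n)" if "n > 0" for n
    using V[OF that] that by simp
  moreover have "of_int (a 0) = poly A 0"
  proof -
    obtain D A' where D: "D \<noteq> 0" "map_poly of_int A' = smult (of_int D) A"
      by (rule clear_denominators)
    have "int p dvd poly A' 0 - D * a 0" if "prime p" for p
    proof -
      have "p > 0" using that by (simp add: prime_gt_0_nat)
      have "rat_of_int (poly A' (int p)) = of_int (D * a p)"
        using A[OF \<open>p > 0\<close>] D(2) by (simp flip: poly_map_poly_of_int)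
      hence "poly A' (int p) = D * a p" by (simp only: of_int_eq_iff)
      moreover have "int p dvd poly A' (int p) - poly A' 0"
        using diff_dvd_poly_diff[of "int p" 0 A'] by simp
      moreover have "int p dvd a p - a 0"
        using a that unfolding primary_pseudo_polynomial_def cong_iff_dvd_diff
        by (metis add_0)
      hence "int p dvd D * (a p - a 0)" by simp
      ultimately have "int p dvd D * (a p - a 0) - (D * a p - poly A' 0)"
        by (metis dvd_diff)
      thus ?thesis by (simp add: algebra_simps)
    qed
    hence "poly A' 0 = D * a 0" using eq_0_if_almost_all_primes_dvd[of 0 "poly A' 0 - D * a 0"] by simp
    hence "of_int D * of_int (a 0) = of_int D * poly A 0"
      using poly_map_poly_of_int[of A' 0, where 'a = rat] D by simp
    thus ?thesis using D(1) by simp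
  qed
  ultimately show ?thesis
    unfolding is_polynomial_seq_def by (metis gr0I of_nat_0)
qed

text \<open>
  The series \<open>1 / (1 - x)\<close> handles constants, and multiplying the sequence by \<open>n\<close> is the operator
  \<open>x d/dx\<close>, which raises the order of the pole at 1 by at most one.
\<close>

lemma fps_poly_values_rational:
  fixes P :: "'a :: field_char_0 poly"
  shows "\<exists>k q. (1 - fps_X) ^ k * Abs_fps (\<lambda>n. poly P (of_nat n)) = fps_of_poly q"
proof (induction P)
  case 0
  show ?case by (intro exI[of _ 0]) (auto intro!: exI[of _ 0] simp: fps_eq_iff)
next
  case (pCons c P)
  define f where "f = Abs_fps (\<lambda>n. poly P (of_nat n))"
  let ?y = "1 - fps_X :: 'a fps"
  obtain k q where kq: "?y ^ k * f = fps_of_poly q"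
    using pCons.IH by (auto simp: f_def)
  have "fps_of_poly (pderiv ([:1, -1:] * q)) = fps_deriv (?y ^ Suc k * f)"
  proof -
    have "fps_of_poly ([:1, -1:] * q) = ?y ^ Suc k * f"
      by (simp add: fps_of_poly_mult fps_of_poly_pCons mult.assoc del: mult_pCons_left flip: kq)
    thus ?thesis by (simp only: fps_of_poly_pderiv)
  qed
  also have "\<dots> = ?y ^ Suc k * fps_deriv f - of_nat (Suc k) * fps_of_poly q"
    unfolding kq[symmetric]
    by (subst fps_deriv_mult, subst fps_deriv_power')
      (simp add: algebra_simps del: of_nat_Suc fps_deriv_power)
  finally have der: "?y ^ Suc k * fps_deriv f =
      fps_of_poly (pderiv ([:1, -1:] * q) + smult (of_nat (Suc k)) q)"
    by (simp add: fps_of_poly_add fps_of_poly_smult fps_of_nat del: of_nat_Suc)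
  have geo: "?y * Abs_fps (\<lambda>n. 1) = 1"
    by (simp add: fps_eq_iff left_diff_distrib)
  have "Abs_fps (\<lambda>n. poly (pCons c P) (of_nat n)) =
      fps_const c * Abs_fps (\<lambda>n. 1) + fps_X * fps_deriv f"
    by (simp add: fps_eq_iff f_def flip: fps_XD_def)
  also have "?y ^ Suc k * \<dots> = fps_const c * ?y ^ k * (?y * Abs_fps (\<lambda>n. 1))
      + fps_X * (?y ^ Suc k * fps_deriv f)"
    by (simp add: algebra_simps)
  also have "\<dots> = fps_of_poly (smult c ([:1, -1:] ^ k) +
      [:0, 1:] * (pderiv ([:1, -1:] * q) + smult (of_nat (Suc k)) q))"
    unfolding geo der
    by (simp only: fps_of_poly_add fps_of_poly_mult fps_of_poly_smult fps_of_poly_power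
        fps_of_poly_pCons) simp
  finally show ?case by blast
qed

lemma is_polynomial_seq_imp_rational:
  assumes "is_polynomial_seq a"
  shows "int_fps_to_rat_fls (Abs_fps a) \<in> rational_functions"
proof -
  obtain P :: "rat poly" where P: "\<And>n. of_int (a n) = poly P (of_nat n)"
    using assms by (auto simp: is_polynomial_seq_def)
  let ?F = "Abs_fps (\<lambda>n. poly P (of_nat n))" and ?r = "[:1, -1:] :: rat poly"
  obtain k q where kq: "(1 - fps_X) ^ k * ?F = fps_of_poly q"
    using fps_poly_values_rational by blast
  have "fps_of_poly (?r ^ k) * ?F = fps_of_poly q"
    unfolding kq[symmetric] by (simp add: fps_of_poly_power fps_of_poly_pCons)
  hence "fps_to_fls (fps_of_poly (?r ^ k)) * fps_to_fls ?F = fps_to_fls (fps_of_poly q)"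
    by (simp flip: fls_times_fps_to_fls)
  moreover have "?r ^ k \<noteq> 0" by simp
  ultimately have "fps_to_fls ?F = fps_to_fls (fps_of_poly q) / fps_to_fls (fps_of_poly (?r ^ k))"
    by (simp add: field_simps del: power_eq_0_iff)
  thus ?thesis
    using \<open>?r ^ k \<noteq> 0\<close> unfolding rational_functions_def int_fps_to_rat_fls_def
    by (auto simp: P simp del: power_eq_0_iff)
qed

section \<open>Algebraic power series over the integers\<close>

lemma int_fps_to_rat_fls_0 [simp]: "int_fps_to_rat_fls 0 = 0"
  by (simp add: int_fps_to_rat_fls_def fps_zero_def[symmetric])

lemma int_fps_to_rat_fls_1 [simp]: "int_fps_to_rat_fls 1 = 1"
proof -
  have "Abs_fps (\<lambda>n. rat_of_int (fps_nth 1 n)) = 1" by (simp add: fps_eq_iff)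
  thus ?thesis by (simp add: int_fps_to_rat_fls_def)
qed

lemma int_fps_to_rat_fls_add:
  "int_fps_to_rat_fls (F + G) = int_fps_to_rat_fls F + int_fps_to_rat_fls G"
  unfolding int_fps_to_rat_fls_def fps_to_fls_plus[symmetric]
  by (rule arg_cong[of _ _ fps_to_fls]) (simp add: fps_eq_iff)

lemma int_fps_to_rat_fls_mult:
  "int_fps_to_rat_fls (F * G) = int_fps_to_rat_fls F * int_fps_to_rat_fls G"
  unfolding int_fps_to_rat_fls_def fls_times_fps_to_fls[symmetric]
  by (rule arg_cong[of _ _ fps_to_fls]) (simp add: fps_eq_iff fps_mult_nth)

lemma int_fps_to_rat_fls_power:
  "int_fps_to_rat_fls (F ^ n) = int_fps_to_rat_fls F ^ n"
  by (induction n) (simp_all add: int_fps_to_rat_fls_mult)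

lemma int_fps_to_rat_fls_sum:
  "int_fps_to_rat_fls (sum f A) = (\<Sum>x\<in>A. int_fps_to_rat_fls (f x))"
  by (induction A rule: infinite_finite_induct) (simp_all add: int_fps_to_rat_fls_add)

lemma int_fps_to_rat_fls_eq_0_iff [simp]: "int_fps_to_rat_fls F = 0 \<longleftrightarrow> F = 0"
  by (auto simp: int_fps_to_rat_fls_def fps_eq_iff)

lemma int_fps_to_rat_fls_of_poly:
  assumes "map_poly of_int p' = p"
  shows "int_fps_to_rat_fls (fps_of_poly p') = fps_to_fls (fps_of_poly p)"
  unfolding int_fps_to_rat_fls_def assms[symmetric]
  by (simp add: fps_eq_iff coeff_map_poly)

lemma rational_function_as_int_quotient:
  assumes "x \<in> rational_functions"
  shows "\<exists>p q :: int poly. q \<noteq> 0 \<and>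
    x * int_fps_to_rat_fls (fps_of_poly q) = int_fps_to_rat_fls (fps_of_poly p)"
proof -
  obtain p q :: "rat poly" where "q \<noteq> 0"
    and x: "x = fps_to_fls (fps_of_poly p) / fps_to_fls (fps_of_poly q)"
    using assms by (auto simp: rational_functions_def)
  obtain D p' where D: "D \<noteq> 0" "map_poly of_int p' = smult (of_int D) p"
    by (rule clear_denominators)
  obtain E q' where E: "E \<noteq> 0" "map_poly of_int q' = smult (of_int E) q"
    by (rule clear_denominators)
  have q'': "map_poly of_int (smult D q') = smult (of_int (D * E)) q"
    and p'': "map_poly of_int (smult E p') = smult (of_int (D * E)) p"
    by (simp_all add: map_poly_smult D E mult.commute)
  have "smult D q' \<noteq> 0"
    using D(1) E \<open>q \<noteq> 0\<close> by auto
  moreover have "x * int_fps_to_rat_fls (fps_of_poly (smult D q')) =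
      int_fps_to_rat_fls (fps_of_poly (smult E p'))"
    unfolding int_fps_to_rat_fls_of_poly[OF q''] int_fps_to_rat_fls_of_poly[OF p''] x
    using \<open>q \<noteq> 0\<close> by (simp add: fps_of_poly_smult fls_times_fps_to_fls)
  ultimately show ?thesis by blast
qed

lemma common_denominator:
  fixes x :: "nat \<Rightarrow> rat fls"
  assumes "\<And>i. x i \<in> rational_functions"
  shows "\<exists>Q A. Q \<noteq> (0 :: int poly) \<and> (\<forall>i\<le>n. x i * int_fps_to_rat_fls (fps_of_poly Q) =
           int_fps_to_rat_fls (fps_of_poly (A i)))"
proof (induction n)
  case 0
  obtain p q :: "int poly" where "q \<noteq> 0"
    "x 0 * int_fps_to_rat_fls (fps_of_poly q) = int_fps_to_rat_fls (fps_of_poly p)"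
    using rational_function_as_int_quotient[OF assms] by blast
  thus ?case by (intro exI[of _ q] exI[of _ "\<lambda>_. p"]) simp
next
  case (Suc n)
  let ?h = "\<lambda>q. int_fps_to_rat_fls (fps_of_poly q)"
  have h_mult: "?h (p * q) = ?h p * ?h q" for p q
    by (simp add: fps_of_poly_mult int_fps_to_rat_fls_mult)
  obtain Q A where Q: "Q \<noteq> 0" "\<And>i. i \<le> n \<Longrightarrow> x i * ?h Q = ?h (A i)"
    using Suc.IH by blast
  obtain p q where q: "q \<noteq> 0" "x (Suc n) * ?h q = ?h p"
    using rational_function_as_int_quotient[OF assms] by blast
  have "x i * ?h (q * Q) = ?h (if i \<le> n then q * A i else Q * p)" if "i \<le> Suc n" for i
  proof (cases "i \<le> n")
    case True
    have "x i * ?h (q * Q) = ?h q * (x i * ?h Q)"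
      by (simp only: h_mult mult_ac)
    also have "\<dots> = ?h (q * A i)"
      by (simp only: Q(2)[OF True] h_mult)
    finally show ?thesis using True by simp
  next
    case False
    have "x (Suc n) * ?h (q * Q) = ?h Q * (x (Suc n) * ?h q)"
      by (simp only: h_mult mult_ac)
    also have "\<dots> = ?h (Q * p)"
      by (simp only: q(2) h_mult)
    finally show ?thesis using False that by (simp add: le_Suc_eq)
  qed
  moreover have "q * Q \<noteq> 0" using Q(1) q(1) by simp
  ultimately show ?case
    by (intro exI[of _ "q * Q"] exI[of _ "\<lambda>i. if i \<le> n then q * A i else Q * p"]) simp
qed

text \<open>
  Algebraicity over the rational functions with all denominators cleared. The coefficients are given by
  a function on the indices and not by a polynomial over polynomials, so that they can be changed one by
  one. As the equation is in integer power series, it can be reduced modulo primes and substituted into.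
\<close>

definition algebraic_int_fps :: "int fps \<Rightarrow> bool" where
  "algebraic_int_fps F \<longleftrightarrow> (\<exists>n (A :: nat \<Rightarrow> int poly).
     (\<exists>i\<le>n. A i \<noteq> 0) \<and> (\<Sum>i\<le>n. fps_of_poly (A i) * F ^ i) = 0)"

lemma algebraic_over_imp_algebraic_int_fps:
  assumes "algebraic_over rational_functions (int_fps_to_rat_fls F)"
  shows "algebraic_int_fps F"
proof -
  let ?h = "\<lambda>q. int_fps_to_rat_fls (fps_of_poly q)"
  obtain P where P: "P \<noteq> 0" "\<And>i. coeff P i \<in> rational_functions"
    "poly P (int_fps_to_rat_fls F) = 0"
    using assms by (auto simp: algebraic_over_def)
  obtain Q A where Q: "Q \<noteq> 0" and A: "\<And>i. i \<le> degree P \<Longrightarrow> coeff P i * ?h Q = ?h (A i)"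
    using common_denominator[of "coeff P" "degree P"] P(2) by blast
  have "?h (A (degree P)) \<noteq> 0"
    using P(1) Q by (simp flip: A)
  hence "A (degree P) \<noteq> 0" by auto
  have "int_fps_to_rat_fls (\<Sum>i\<le>degree P. fps_of_poly (A i) * F ^ i) =
      (\<Sum>i\<le>degree P. ?h Q * (coeff P i * int_fps_to_rat_fls F ^ i))"
    by (auto simp: int_fps_to_rat_fls_sum int_fps_to_rat_fls_mult int_fps_to_rat_fls_power
        mult_ac simp flip: A intro!: sum.cong)
  also have "\<dots> = ?h Q * poly P (int_fps_to_rat_fls F)"
    by (simp add: poly_altdef sum_distrib_left)
  finally have "(\<Sum>i\<le>degree P. fps_of_poly (A i) * F ^ i) = 0"
    using P(3) by simp
  thus ?thesis
    using \<open>A (degree P) \<noteq> 0\<close> unfolding algebraic_int_fps_def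
    by (intro exI[of _ "degree P"] exI[of _ A]) auto
qed

text \<open>
  The divisibility assumption makes the series a polynomial modulo each prime \<open>p\<close>. By
  \<open>degree_bound_mod_prime\<close>, its degree is then at most \<open>d\<close>, the largest degree of a
  coefficient of the algebraic equation, as long as the equation does not vanish modulo \<open>p\<close>. This excludes
  finitely many primes, so every \<open>b k\<close> with \<open>k > d\<close> has infinitely many prime divisors.
\<close>

lemma algebraic_divisible_imp_finite:
  fixes b :: "nat \<Rightarrow> int"
  assumes alg: "algebraic_int_fps (Abs_fps b)"
    and dvd: "\<And>n p. prime p \<Longrightarrow> p \<le> n \<Longrightarrow> int p dvd b n"
  shows "\<exists>d. \<forall>k>d. b k = 0"
proof -
  obtain n j and A :: "nat \<Rightarrow> int poly" where j: "j \<le> n" "A j \<noteq> 0"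
    and rel: "(\<Sum>i\<le>n. fps_of_poly (A i) * Abs_fps b ^ i) = 0"
    using alg by (auto simp: algebraic_int_fps_def)
  define d where "d = Max ((\<lambda>i. degree (A i)) ` {..n})"
  have deg: "degree (A i) \<le> d" if "i \<le> n" for i
    using that by (auto simp: d_def intro!: Max_ge)
  define c where "c = lead_coeff (A j)"
  have "c \<noteq> 0" using j by (simp add: c_def)
  have "b k = 0" if "k > d" for k
  proof (rule eq_0_if_almost_all_primes_dvd)
    fix p assume p: "prime p" "p > nat \<bar>c\<bar>"
    have "\<not> int p dvd coeff (A j) (degree (A j))"
      using zdvd_imp_le[of "int p" "\<bar>c\<bar>"] \<open>c \<noteq> 0\<close> p(2) by (auto simp: c_def)
    moreover have "degree_mod_le (int p) (Abs_fps b) p"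
      using dvd[OF p(1)] by (simp add: degree_mod_le_def)
    ultimately have "degree_mod_le (int p) (Abs_fps b) d"
      using degree_bound_mod_prime[OF rel deg _ j(1)] p(1) by auto
    thus "int p dvd b k" using that by (simp add: degree_mod_le_def)
  qed
  thus ?thesis by blast
qed

section \<open>The binomial transform as a substitution\<close>

text \<open>
  The expansion of \<open>x^k / (1 + x)^(k + 1)\<close>, given by its coefficients so that it is visibly an
  integer power series. In particular \<open>fps_X * binomial_fps 0\<close> is
  the series \<open>x / (1 + x)\<close>.
\<close>

definition binomial_fps :: "nat \<Rightarrow> int fps" where
  "binomial_fps k = Abs_fps (\<lambda>n. (-1) ^ (n - k) * int (n choose k))"

lemma one_plus_X_mult_nth:
  "fps_nth ((1 + fps_X) * (F :: int fps)) n = fps_nth F n + (if n = 0 then 0 else fps_nth F (n - 1))"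
  by (simp add: distrib_right)

lemma binomial_fps_0: "(1 + fps_X) * binomial_fps 0 = 1"
proof (rule fps_ext)
  fix n show "fps_nth ((1 + fps_X) * binomial_fps 0) n = fps_nth 1 n"
    unfolding one_plus_X_mult_nth by (cases n) (auto simp: binomial_fps_def)
qed

lemma binomial_fps_Suc: "(1 + fps_X) * binomial_fps (Suc k) = fps_X * binomial_fps k"
proof (rule fps_ext)
  fix n show "fps_nth ((1 + fps_X) * binomial_fps (Suc k)) n = fps_nth (fps_X * binomial_fps k) n"
  proof (cases n)
    case (Suc m)
    have "(-1) ^ (m - k) * int (m choose Suc k) + (-1) ^ (m - Suc k) * int (m choose Suc k) = 0"
    proof (cases "m > k")
      case True
      hence "m - k = Suc (m - Suc k)" by simp
      thus ?thesis by simp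
    qed simp
    thus ?thesis
      unfolding one_plus_X_mult_nth Suc by (simp add: binomial_fps_def algebra_simps)
  qed (simp add: binomial_fps_def one_plus_X_mult_nth)
qed

lemma binomial_fps_power:
  "(fps_X * binomial_fps 0) ^ k = (1 + fps_X) * binomial_fps k"
proof (induction k)
  case (Suc k)
  have "(fps_X * binomial_fps 0) ^ Suc k =
      fps_X * binomial_fps k * ((1 + fps_X) * binomial_fps 0)"
    by (simp add: Suc.IH mult_ac)
  thus ?case by (simp add: binomial_fps_0 binomial_fps_Suc)
qed (simp add: binomial_fps_0)

text \<open>
  This is \<open>f_a (x / (1 + x)) = (1 + x) * f_b x\<close>: the coefficient of \<open>a k\<close> on both sides is
  \<open>x^k / (1 + x)^k\<close>.
\<close>

lemma compose_eq_binomial_transform: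
  "Abs_fps a oo (fps_X * binomial_fps 0) = (1 + fps_X) * Abs_fps (binomial_transform a)"
proof (rule fps_ext)
  fix n
  have bt: "binomial_transform a m = (\<Sum>k=0..n. a k * fps_nth (binomial_fps k) m)"
    if "m \<le> n" for m
    unfolding binomial_transform_def using that
    by (intro sum.mono_neutral_cong_left) (auto simp: binomial_fps_def)
  show "fps_nth (Abs_fps a oo (fps_X * binomial_fps 0)) n =
      fps_nth ((1 + fps_X) * Abs_fps (binomial_transform a)) n"
    unfolding fps_compose_nth binomial_fps_power one_plus_X_mult_nth
    using bt[of n] bt[of "n - 1"] by (simp add: distrib_left sum.distrib)
qed

text \<open>
  Multiplying \<open>p (x / (1 + x))\<close> by \<open>(1 + x)^d\<close> homogenises \<open>p\<close>.
\<close>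

lemma compose_poly_clear_denominator:
  assumes "degree p \<le> d"
  shows "\<exists>B. fps_of_poly B = (fps_of_poly p oo (fps_X * binomial_fps 0)) * (1 + fps_X) ^ d"
  using assms
proof (induction p arbitrary: d)
  case 0
  show ?case by (intro exI[of _ 0]) simp
next
  case (pCons c p)
  let ?w = "fps_X * binomial_fps 0" and ?z = "1 + fps_X :: int fps"
  have comp: "fps_of_poly (pCons c p) oo ?w = fps_const c + ?w * (fps_of_poly p oo ?w)"
    by (simp add: fps_of_poly_pCons fps_compose_add_distrib fps_compose_mult_distrib mult.commute)
  have const: "fps_of_poly (smult c ([:1, 1:] ^ d)) = fps_const c * ?z ^ d"
    by (simp add: fps_of_poly_smult fps_of_poly_power fps_of_poly_pCons)
  show ?case
  proof (cases "p = 0")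
    case True
    thus ?thesis using comp const by (intro exI[of _ "smult c ([:1, 1:] ^ d)"]) simp
  next
    case False
    then obtain d' where d: "d = Suc d'" "degree p \<le> d'"
      using pCons.prems by (cases d) auto
    then obtain B where B: "fps_of_poly B = (fps_of_poly p oo ?w) * ?z ^ d'"
      using pCons.IH by blast
    have "(fps_of_poly (pCons c p) oo ?w) * ?z ^ d =
        fps_const c * ?z ^ d + (?z * binomial_fps 0) * fps_X * ((fps_of_poly p oo ?w) * ?z ^ d')"
    proof -
      have "(f + fps_X * h * g) * (z * y) = f * (z * y) + (z * h) * fps_X * (g * y)"
        for f g h y z :: "int fps"
        by (simp add: algebra_simps)
      thus ?thesis unfolding comp d(1) power_Suc .
    qed
    also have "\<dots> = fps_of_poly (smult c ([:1, 1:] ^ d) + pCons 0 B)"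
      unfolding fps_of_poly_add const by (simp add: binomial_fps_0 fps_of_poly_pCons B)
    finally show ?thesis by metis
  qed
qed

text \<open>
  Substituting \<open>x / (1 + x)\<close> into an equation for \<open>f_a\<close> and multiplying by a power of
  \<open>1 + x\<close> gives a polynomial equation for \<open>(1 + x) * f_b\<close>, hence for \<open>f_b\<close>.
\<close>

lemma algebraic_binomial_transform:
  assumes "algebraic_int_fps (Abs_fps a)"
  shows "algebraic_int_fps (Abs_fps (binomial_transform a))"
proof -
  let ?w = "fps_X * binomial_fps 0" and ?z = "1 + fps_X :: int fps"
  let ?G = "Abs_fps (binomial_transform a)"
  obtain n j and A :: "nat \<Rightarrow> int poly" where j: "j \<le> n" "A j \<noteq> 0"
    and rel: "(\<Sum>i\<le>n. fps_of_poly (A i) * Abs_fps a ^ i) = 0"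
    using assms by (auto simp: algebraic_int_fps_def)
  define d where "d = Max ((\<lambda>i. degree (A i)) ` {..n})"
  have deg: "degree (A i) \<le> d" if "i \<le> n" for i
    using that by (auto simp: d_def intro!: Max_ge)
  have "\<forall>i\<in>{..n}. \<exists>B. fps_of_poly B = (fps_of_poly (A i) oo ?w) * ?z ^ d"
    using compose_poly_clear_denominator deg by blast
  then obtain B where B: "\<And>i. i \<le> n \<Longrightarrow> fps_of_poly (B i) = (fps_of_poly (A i) oo ?w) * ?z ^ d"
    unfolding bchoice_iff by auto
  have w0: "fps_nth ?w 0 = 0" by simp
  have w_nz: "?w \<noteq> 0"
    using binomial_fps_0 by auto
  have z_nz: "?z \<noteq> 0"
    using binomial_fps_0 by auto
  have z_poly: "fps_of_poly [:1, 1:] = ?z"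
    by (simp add: fps_of_poly_pCons)
  \<comment> \<open>Substituting a nonzero series without constant term is injective, so the new equation is nontrivial.\<close>
  have "fps_of_poly (B j) \<noteq> 0"
    using j w_nz z_nz by (simp add: B fps_compose_eq_0_iff)
  hence nonzero: "B j * [:1, 1:] ^ j \<noteq> 0" by auto
  have rel': "(\<Sum>i\<le>n. fps_of_poly (B i * [:1, 1:] ^ i) * ?G ^ i) = 0"
  proof -
    have "(\<Sum>i\<le>n. fps_of_poly (B i * [:1, 1:] ^ i) * ?G ^ i) =
        ?z ^ d * (\<Sum>i\<le>n. (fps_of_poly (A i) oo ?w) * (?z * ?G) ^ i)"
      unfolding sum_distrib_left
      by (intro sum.cong refl)
        (simp add: fps_of_poly_mult fps_of_poly_power z_poly B power_mult_distrib mult_ac)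
    also have "(\<Sum>i\<le>n. (fps_of_poly (A i) oo ?w) * (?z * ?G) ^ i) =
        (\<Sum>i\<le>n. fps_of_poly (A i) * Abs_fps a ^ i) oo ?w"
      by (simp add: fps_compose_sum_distrib fps_compose_mult_distrib fps_compose_power
          flip: compose_eq_binomial_transform)
    finally show ?thesis by (simp add: rel)
  qed
  show ?thesis
    unfolding algebraic_int_fps_def
    by (intro exI[of _ n] exI[of _ "\<lambda>i. B i * [:1, 1:] ^ i"] conjI exI[of _ j])
      (fact j(1) nonzero rel')+
qed

section \<open>Algebraic generating functions of primary pseudo-polynomials\<close>

lemma primary_pseudo_polynomial_deriv:
  assumes "primary_pseudo_polynomial a"
  shows "primary_pseudo_polynomial (\<lambda>n. int (Suc n) * a (Suc n))"
  unfolding primary_pseudo_polynomial_def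
proof safe
  fix n p :: nat assume "prime p"
  hence "[a (Suc n + p) = a (Suc n)] (mod int p)"
    using assms unfolding primary_pseudo_polynomial_def by blast
  moreover have "[int (Suc (n + p)) = int (Suc n)] (mod int p)"
    by (simp add: cong_iff_dvd_diff)
  ultimately show "[int (Suc (n + p)) * a (Suc (n + p)) = int (Suc n) * a (Suc n)] (mod int p)"
    using cong_mult by fastforce
qed

lemma is_polynomial_seq_if_algebraic:
  assumes a: "primary_pseudo_polynomial a" and alg: "algebraic_int_fps (Abs_fps a)"
  shows "is_polynomial_seq a"
proof -
  have "\<exists>d. \<forall>k>d. binomial_transform a k = 0"
    using algebraic_binomial_transform[OF alg] prime_dvd_binomial_transform[OF a]
    by (rule algebraic_divisible_imp_finite)
  thus ?thesis using is_polynomial_seq_if_binomial_transform_finite by blast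
qed

text \<open>
  The coefficients of each derivative form again a primary pseudo-polynomial, so the case without
  derivatives applies to the \<open>m\<close>-th derivative; the derivatives are then undone one at a time.
\<close>

lemma is_polynomial_seq_if_derivative_algebraic:
  assumes "primary_pseudo_polynomial a"
    and "algebraic_int_fps ((fps_deriv ^^ m) (Abs_fps a))"
  shows "is_polynomial_seq a"
  using assms
proof (induction m arbitrary: a)
  case 0
  thus ?case by (simp add: is_polynomial_seq_if_algebraic)
next
  case (Suc m)
  let ?u = "\<lambda>n. int (Suc n) * a (Suc n)"
  have "fps_deriv (Abs_fps a) = Abs_fps ?u"
    by (simp add: fps_eq_iff)
  hence "is_polynomial_seq ?u"
    using Suc.prems primary_pseudo_polynomial_deriv
    by (intro Suc.IH) (simp_all add: funpow_swap1 del: of_nat_Suc)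
  thus ?case by (rule is_polynomial_seq_if_derivative[OF Suc.prems(1)])
qed

theorem theorem2:
  fixes a b :: "nat \<Rightarrow> int"
  assumes "primary_pseudo_polynomial a"
    and "b = binomial_transform a"
  shows "((\<exists>m::nat. algebraic_over rational_functions
              (int_fps_to_rat_fls ((fps_deriv ^^ m) (Abs_fps a))))
            \<longrightarrow> is_polynomial_seq a \<and> int_fps_to_rat_fls (Abs_fps a) \<in> rational_functions)
       \<and> (algebraic_over rational_functions (int_fps_to_rat_fls (Abs_fps b))
            \<longrightarrow> (\<exists>q :: int poly. Abs_fps b = fps_of_poly q))"
proof (intro conjI impI; (elim exE)?)
  fix m
  assume "algebraic_over rational_functions
            (int_fps_to_rat_fls ((fps_deriv ^^ m) (Abs_fps a)))"
  thus "is_polynomial_seq a"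
    using is_polynomial_seq_if_derivative_algebraic[OF assms(1)]
      algebraic_over_imp_algebraic_int_fps by blast
  thus "int_fps_to_rat_fls (Abs_fps a) \<in> rational_functions"
    by (rule is_polynomial_seq_imp_rational)
next
  assume "algebraic_over rational_functions (int_fps_to_rat_fls (Abs_fps b))"
  hence alg: "algebraic_int_fps (Abs_fps b)"
    by (rule algebraic_over_imp_algebraic_int_fps)
  have dvd: "int p dvd b n" if "prime p" "p \<le> n" for p n
    unfolding assms(2) using assms(1) that by (rule prime_dvd_binomial_transform)
  obtain d where "\<forall>k>d. b k = 0"
    using algebraic_divisible_imp_finite[OF alg dvd] by blast
  hence "coeff (Abs_poly b) = b"
    by (intro coeff_Abs_poly[of d]) simp
  hence "Abs_fps b = fps_of_poly (Abs_poly b)"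
    by (simp add: fps_eq_iff)
  thus "\<exists>q :: int poly. Abs_fps b = fps_of_poly q" by blast
qed

end
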